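(* Let $m\in\mathbb{N}$ and let $\mathbf{X}$ be a (not necessarily ergodic) $\mathbb{R}^{m}$-system. Then $W(\mathbf{X})$ is the union of at most countably many proper linear subspaces of $\mathbb{R}^{m}$.
   Context: An $\mathbb{R}^m$-system is a tuple $\mathbf{X}=(X,\mathcal{X},\mu,(T_{g})_{g\in\mathbb{R}^m})$ where $(X,\mathcal{X},\mu)$ is a separable probability space and $T_g\colon X\to X$, $g\in\mathbb{R}^m$, are measurable, measure preserving transformations with $T_g\circ T_h=T_{g+h}$ and $T_0=\mathrm{id}$ for all $g,h\in\mathbb{R}^m$, such that for every $x\in X$ the map $g\mapsto T_gx$ from $\mathbb{R}^m$ to $X$ is measurable. For a subgroup $H$ of $\mathbb{R}^m$, $I(H)$ is the sub-$\sigma$-algebra of $\mathcal{X}$ of all $H$-invariant sets; equality of such $\sigma$-algebras is understood modulo $\mu$-null sets. $W(\mathbf{X})$ is the set of all $\alpha\in\mathbb{R}^m$ such that $I((t\alpha)_{t\in\mathbb{R}})\neq I(\mathbb{R}^m)$. The empty set counts as the union of the empty family. *)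

theory Defs
  imports "HOL-Probability.Probability"
begin

(* Separability of the measure algebra of M (metric mu(A symmetric-difference B)); in particular
   every countably generated sigma-algebra qualifies. *)
definition separable_measure :: "'a measure \<Rightarrow> bool" where
  "separable_measure M \<longleftrightarrow>
     (\<exists>\<C>. countable \<C> \<and> \<C> \<subseteq> sets M \<and>
        (\<forall>A\<in>sets M. \<forall>e>0. \<exists>C\<in>\<C>. measure M (sym_diff A C) < e))"

(* The action laws are required on space M only: T g is irrelevant outside it. *)
locale R_system = prob_space M
  for M :: "'a measure" and T :: "real ^ 'm \<Rightarrow> 'a \<Rightarrow> 'a" +
  assumes separable: "separable_measure M"
    and T_measurable: "\<And>g. T g \<in> M \<rightarrow>\<^sub>M M"
    and T_preserving: "\<And>g A. A \<in> sets M \<Longrightarrow> emeasure M (T g -` A \<inter> space M) = emeasure M A"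
    and T_add: "\<And>g h x. x \<in> space M \<Longrightarrow> T g (T h x) = T (g + h) x"
    and T_zero: "\<And>x. x \<in> space M \<Longrightarrow> T 0 x = x"
    and orbit_measurable: "\<And>x. x \<in> space M \<Longrightarrow> (\<lambda>g. T g x) \<in> borel \<rightarrow>\<^sub>M M"

(* I(H). Invariance of a set is modulo null sets, separately for each h in H. The null set may
   depend on h; since only separate (not joint) measurability of the action is assumed, this
   need not agree, even modulo null sets, with strict invariance under an uncountable H. *)
definition invariant_sets ::
    "'a measure \<Rightarrow> (real ^ 'm \<Rightarrow> 'a \<Rightarrow> 'a) \<Rightarrow> (real ^ 'm) set \<Rightarrow> 'a set set" where
  "invariant_sets M T H =
     {A \<in> sets M. \<forall>h\<in>H. AE x in M. T h x \<in> A \<longleftrightarrow> x \<in> A}"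

definition eq_mod_null :: "'a measure \<Rightarrow> 'a set set \<Rightarrow> 'a set set \<Rightarrow> bool" where
  "eq_mod_null M \<A> \<B> \<longleftrightarrow>
     (\<forall>A\<in>\<A>. \<exists>B\<in>\<B>. AE x in M. x \<in> A \<longleftrightarrow> x \<in> B) \<and>
     (\<forall>B\<in>\<B>. \<exists>A\<in>\<A>. AE x in M. x \<in> A \<longleftrightarrow> x \<in> B)"

definition W_set :: "'a measure \<Rightarrow> (real ^ 'm \<Rightarrow> 'a \<Rightarrow> 'a) \<Rightarrow> (real ^ 'm) set" where
  "W_set M T =
     {\<alpha>. \<not> eq_mod_null M (invariant_sets M T (range (\<lambda>t::real. t *\<^sub>R \<alpha>)))
                          (invariant_sets M T UNIV)}"

lemma (in R_system) sigma_algebra_invariant_sets: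
  "sigma_algebra (space M) (invariant_sets M T H)"
proof -
  have T_sp: "T g x \<in> space M" if "x \<in> space M" for g x
    using measurable_space[OF T_measurable that] .
  show ?thesis
    unfolding sigma_algebra_iff2
  proof (intro conjI ballI allI impI)
    show "invariant_sets M T H \<subseteq> Pow (space M)"
      using sets.sets_into_space by (auto simp: invariant_sets_def)
    show "{} \<in> invariant_sets M T H" by (simp add: invariant_sets_def)
  next
    fix A assume A: "A \<in> invariant_sets M T H"
    have "AE x in M. T h x \<in> space M - A \<longleftrightarrow> x \<in> space M - A" if "h \<in> H" for h
    proof -
      have "AE x in M. T h x \<in> A \<longleftrightarrow> x \<in> A" using A that by (simp add: invariant_sets_def)
      then show ?thesis using AE_space by eventually_elim (auto simp: T_sp)
    qed
    then show "space M - A \<in> invariant_sets M T H" using A by (simp add: invariant_sets_def sets.compl_sets)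
  next
    fix A :: "nat \<Rightarrow> 'a set" assume A: "range A \<subseteq> invariant_sets M T H"
    have "AE x in M. T h x \<in> (\<Union>i. A i) \<longleftrightarrow> x \<in> (\<Union>i. A i)" if "h \<in> H" for h
    proof -
      have "AE x in M. \<forall>i. T h x \<in> A i \<longleftrightarrow> x \<in> A i"
        using A that by (auto simp: AE_all_countable invariant_sets_def)
      then show ?thesis by eventually_elim auto
    qed
    then show "(\<Union>i. A i) \<in> invariant_sets M T H" using A by (auto simp: invariant_sets_def)
  qed
qed

end

(* For a subspace V let E_V be the conditional expectation onto I(V). As the group is abelian,
   E_V preserves invariance under other subgroups, so E_W 1_A is measurable with respect to
   I(V + W) whenever A lies in I(V). Consider the subspaces V that are maximal with
   I(V) \<noteq> I(R^m), and choose for each of them A_V in I(V) outside I(R^m). If V and W are two of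
   them, maximality gives I(V + W) = I(R^m), so 1_A - E 1_A for A = A_V (E onto I(R^m)) is
   orthogonal to the indicator of A_W. Hence A_V has distance at least
   c_V = ||1_A - E 1_A||^2 > 0 from every other A_W, and separability leaves only countably many V.
   Dimensions being bounded, every line through a point of W(X) lies in such a V. *)
theory Submission
  imports Defs
begin

context R_system
begin

section \<open>Measure-preserving shifts and the families of invariant sets\<close>

lemma T_in_space: "x \<in> space M \<Longrightarrow> T g x \<in> space M"
  using measurable_space[OF T_measurable] .

lemma distr_T: "distr M M (T g) = M"
  by (rule measure_eqI) (auto simp: emeasure_distr T_measurable T_preserving)

lemma AE_shift: "AE x in M. P x \<Longrightarrow> AE x in M. P (T g x)"
  using AE_distrD[OF T_measurable[of g], of P] by (simp only: distr_T)

lemma integrable_indicator_event: "A \<in> sets M \<Longrightarrow> integrable M (indicator A :: 'a \<Rightarrow> real)"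
  by (simp add: integrable_indicator_iff less_top[symmetric])

lemma integral_shift:
  fixes f :: "'a \<Rightarrow> real"
  assumes "f \<in> borel_measurable M"
  shows "(\<integral>x. f (T g x) \<partial>M) = (\<integral>x. f x \<partial>M)"
  using integral_distr[OF T_measurable assms, of g] by (simp add: distr_T)

lemma integrable_shift:
  fixes f :: "'a \<Rightarrow> real"
  assumes "integrable M f"
  shows "integrable M (\<lambda>x. f (T g x))"
  by (rule integrable_distr[OF T_measurable]) (simp add: distr_T assms)

lemma invariant_sets_antimono: "H \<subseteq> K \<Longrightarrow> invariant_sets M T K \<subseteq> invariant_sets M T H"
  by (auto simp: invariant_sets_def)

text \<open>Since \<open>T h\<close> and \<open>T g\<close> commute, the exceptional null set for
  the preimage and \<open>h\<close> is the preimage under \<open>T g\<close> of the one for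
  \<open>B\<close> and \<open>h\<close>, which is null again.\<close>

lemma vimage_T_invariant_sets:
  assumes "B \<in> invariant_sets M T H"
  shows "T g -` B \<inter> space M \<in> invariant_sets M T H"
proof -
  have "AE x in M. T h x \<in> T g -` B \<inter> space M \<longleftrightarrow> x \<in> T g -` B \<inter> space M" if "h \<in> H" for h
  proof -
    have "AE x in M. T h (T g x) \<in> B \<longleftrightarrow> T g x \<in> B"
      using assms that by (intro AE_shift) (auto simp: invariant_sets_def)
    then show ?thesis
      using AE_space
      by eventually_elim (auto simp: T_in_space T_add add.commute)
  qed
  then show ?thesis
    using assms measurable_sets[OF T_measurable] by (auto simp: invariant_sets_def)
qed

text \<open>Write \<open>T (h + k)\<close> as \<open>T h\<close> after \<open>T k\<close> and pull
  the null set of \<open>h\<close> back along \<open>T k\<close>. For subspaces the sumset is again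
  a subspace. Each pair \<open>h\<close>, \<open>k\<close> costs only two null sets, so uncountable
  groups cause no trouble.\<close>

lemma invariant_sets_sums:
  assumes "A \<in> invariant_sets M T H" "A \<in> invariant_sets M T K"
  shows "A \<in> invariant_sets M T {h + k |h k. h \<in> H \<and> k \<in> K}"
proof -
  have "AE x in M. T (h + k) x \<in> A \<longleftrightarrow> x \<in> A" if "h \<in> H" "k \<in> K" for h k
  proof -
    have "AE x in M. T h (T k x) \<in> A \<longleftrightarrow> T k x \<in> A"
      using assms that by (intro AE_shift) (auto simp: invariant_sets_def)
    moreover have "AE x in M. T k x \<in> A \<longleftrightarrow> x \<in> A"
      using assms that by (auto simp: invariant_sets_def)
    ultimately show ?thesis
      using AE_space by eventually_elim (auto simp: T_add)
  qed
  then show ?thesis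
    using assms by (auto simp: invariant_sets_def)
qed

text \<open>Invariance modulo null sets ignores null modifications. Hence comparing such families
  modulo null sets is the same as comparing them literally.\<close>

lemma invariant_sets_AE_cong:
  assumes "B \<in> invariant_sets M T H" "A \<in> sets M" "AE x in M. x \<in> A \<longleftrightarrow> x \<in> B"
  shows "A \<in> invariant_sets M T H"
proof -
  have "AE x in M. T h x \<in> A \<longleftrightarrow> x \<in> A" if "h \<in> H" for h
  proof -
    have "AE x in M. T h x \<in> B \<longleftrightarrow> x \<in> B"
      using assms that by (auto simp: invariant_sets_def)
    with AE_shift[OF assms(3), of h] assms(3) show ?thesis
      by eventually_elim auto
  qed
  then show ?thesis
    using assms by (auto simp: invariant_sets_def)
qed

section \<open>Conditional expectation onto the invariant sigma-algebras\<close>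

abbreviation invariant_algebra :: "(real ^ 'm) set \<Rightarrow> 'a measure" where
  "invariant_algebra H \<equiv> sigma (space M) (invariant_sets M T H)"

lemma sets_invariant_algebra [simp]: "sets (invariant_algebra H) = invariant_sets M T H"
  by (rule sigma_algebra.sets_measure_of_eq[OF sigma_algebra_invariant_sets])

lemma space_invariant_algebra [simp]: "space (invariant_algebra H) = space M"
  by (rule space_measure_of_conv)

lemma finite_measure_subalgebra_invariant: "finite_measure_subalgebra M (invariant_algebra H)"
proof
  have "invariant_sets M T H \<subseteq> sets M"
    by (auto simp: invariant_sets_def)
  then show "subalgebra M (invariant_algebra H)"
    by (simp add: subalgebra_def)
qed

definition invariant_exp :: "(real ^ 'm) set \<Rightarrow> ('a \<Rightarrow> real) \<Rightarrow> 'a \<Rightarrow> real" where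
  "invariant_exp H = real_cond_exp M (invariant_algebra H)"

lemma borel_measurable_invariant_exp:
  "invariant_exp H f \<in> borel_measurable (invariant_algebra H)"
  unfolding invariant_exp_def by (rule borel_measurable_cond_exp)

lemma integrable_invariant_exp:
  assumes "integrable M f"
  shows "integrable M (invariant_exp H f)"
proof -
  interpret F: finite_measure_subalgebra M "invariant_algebra H"
    by (rule finite_measure_subalgebra_invariant)
  show ?thesis
    unfolding invariant_exp_def using assms by (rule F.real_cond_exp_int)
qed

lemma set_integral_invariant_exp:
  assumes "integrable M f" "B \<in> invariant_sets M T H"
  shows "(\<integral>x\<in>B. invariant_exp H f x \<partial>M) = (\<integral>x\<in>B. f x \<partial>M)"
proof -
  interpret F: finite_measure_subalgebra M "invariant_algebra H"
    by (rule finite_measure_subalgebra_invariant)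
  show ?thesis
    unfolding invariant_exp_def using assms by (intro F.real_cond_exp_intA[symmetric]) auto
qed

lemma invariant_exp_charact:
  assumes "integrable M f" "integrable M g" "g \<in> borel_measurable (invariant_algebra H)"
    and "\<And>B. B \<in> invariant_sets M T H \<Longrightarrow> (\<integral>x\<in>B. f x \<partial>M) = (\<integral>x\<in>B. g x \<partial>M)"
  shows "AE x in M. invariant_exp H f x = g x"
proof -
  interpret F: finite_measure_subalgebra M "invariant_algebra H"
    by (rule finite_measure_subalgebra_invariant)
  show ?thesis
    unfolding invariant_exp_def using assms by (intro F.real_cond_exp_charact) auto
qed

lemma invariant_exp_bounds:
  assumes "integrable M f" "\<And>x. f x \<in> {0..1}"
  shows "AE x in M. invariant_exp H f x \<in> {0..1}"
proof -
  interpret F: finite_measure_subalgebra M "invariant_algebra H"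
    by (rule finite_measure_subalgebra_invariant)
  have "AE x in M. invariant_exp H f x \<ge> 0" "AE x in M. invariant_exp H f x \<le> 1"
    unfolding invariant_exp_def using assms
    by (auto intro!: F.real_cond_exp_ge_c F.real_cond_exp_le_c)
  then show ?thesis
    by eventually_elim simp
qed

text \<open>As the group is abelian, \<open>T g\<close> preserves \<open>I(H)\<close>.\<close>
lemma invariant_exp_shift:
  assumes f: "integrable M f" and inv: "AE x in M. f (T g x) = f x"
  shows "AE x in M. invariant_exp H f (T g x) = invariant_exp H f x"
proof -
  define e where "e = invariant_exp H f"
  have e: "integrable M e"
    unfolding e_def using f by (rule integrable_invariant_exp)
  have eH: "e \<in> borel_measurable (invariant_algebra H)"
    unfolding e_def by (rule borel_measurable_invariant_exp)
  \<comment> \<open>By uniqueness of conditional expectations it suffices that \<open>e\<close>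
    composed with \<open>T g\<close> is also a version of the conditional expectation of
    \<open>f\<close>.\<close>
  have "AE x in M. invariant_exp H f x = e (T g x)"
  proof (rule invariant_exp_charact[OF f integrable_shift[OF e]])
    have "T g \<in> invariant_algebra H \<rightarrow>\<^sub>M invariant_algebra H"
      by (rule measurableI) (auto simp: T_in_space vimage_T_invariant_sets)
    from measurable_compose[OF this eH]
    show "(\<lambda>x. e (T g x)) \<in> borel_measurable (invariant_algebra H)" .
  next
    fix B assume B: "B \<in> invariant_sets M T H"
    \<comment> \<open>This is the image of \<open>B\<close> under \<open>T g\<close>, written as a
      preimage under the inverse shift so that its membership in I(H) is already known. Integrals
      over \<open>B\<close> of shifted functions become integrals over \<open>C\<close>.\<close>
    define C where "C = T (- g) -` B \<inter> space M"
    have C: "C \<in> invariant_sets M T H"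
      unfolding C_def using B by (rule vimage_T_invariant_sets)
    then have CM: "C \<in> sets M"
      by (simp add: invariant_sets_def)
    have BC: "indicator B x = (indicator C (T g x) :: real)" if "x \<in> space M" for x
      using that by (simp add: C_def T_in_space T_add T_zero indicator_def)
    have *: "(\<integral>x\<in>B. u (T g x) \<partial>M) = (\<integral>x\<in>C. u x \<partial>M)" if "integrable M u" for u :: "'a \<Rightarrow> real"
    proof -
      have "(\<integral>x\<in>B. u (T g x) \<partial>M) = (\<integral>x. indicator C (T g x) *\<^sub>R u (T g x) \<partial>M)"
        unfolding set_lebesgue_integral_def by (intro Bochner_Integration.integral_cong) (auto simp: BC)
      also have "\<dots> = (\<integral>x\<in>C. u x \<partial>M)"
        unfolding set_lebesgue_integral_def
        using CM that by (intro integral_shift[of "\<lambda>x. indicator C x *\<^sub>R u x"]) auto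
      finally show ?thesis .
    qed
    have BM: "B \<in> sets M"
      using B by (simp add: invariant_sets_def)
    have "(\<integral>x\<in>B. f x \<partial>M) = (\<integral>x\<in>B. f (T g x) \<partial>M)"
      using inv f integrable_shift[OF f] BM
      by (intro set_lebesgue_integral_cong_AE) auto
    also have "\<dots> = (\<integral>x\<in>C. f x \<partial>M)"
      by (rule *[OF f])
    also have "\<dots> = (\<integral>x\<in>C. e x \<partial>M)"
      unfolding e_def by (rule set_integral_invariant_exp[OF f C, symmetric])
    also have "\<dots> = (\<integral>x\<in>B. e (T g x) \<partial>M)"
      by (rule *[OF e, symmetric])
    finally show "(\<integral>x\<in>B. f x \<partial>M) = (\<integral>x\<in>B. e (T g x) \<partial>M)" .
  qed
  then show ?thesis
    by eventually_elim (simp add: e_def)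
qed

text \<open>The expectation onto I(K) inherits invariance under \<open>H\<close> from
  \<open>A\<close>, so its superlevel sets lie in I(H + K) and hence in I(R^m). It is thus
  measurable for the smaller sigma-algebra, and uniqueness identifies the two expectations.\<close>

lemma invariant_exp_eq_UNIV:
  assumes A: "A \<in> invariant_sets M T H"
    and HK: "invariant_sets M T {h + k |h k. h \<in> H \<and> k \<in> K} \<subseteq> invariant_sets M T UNIV"
  shows "AE x in M. invariant_exp UNIV (indicator A) x = invariant_exp K (indicator A) x"
proof -
  define e where "e = invariant_exp K (indicator A)"
  have AM: "A \<in> sets M"
    using A by (simp add: invariant_sets_def)
  then have f: "integrable M (indicator A :: 'a \<Rightarrow> real)"
    by (rule integrable_indicator_event)
  have "{x \<in> space M. a < e x} \<in> invariant_sets M T UNIV" (is "?B \<in> _") for a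
  proof -
    have BK: "?B \<in> invariant_sets M T K"
      using borel_measurable_invariant_exp[of K "indicator A"]
      by (simp add: borel_measurable_iff_greater e_def)
    moreover have "?B \<in> invariant_sets M T H"
    proof -
      have "AE x in M. T h x \<in> ?B \<longleftrightarrow> x \<in> ?B" if "h \<in> H" for h
      proof -
        have "AE x in M. indicator A (T h x) = (indicator A x :: real)"
          using A that by (auto simp: invariant_sets_def indicator_def)
        from invariant_exp_shift[OF f this, of K] show ?thesis
          using AE_space by eventually_elim (auto simp: e_def T_in_space)
      qed
      then show ?thesis
        using BK by (auto simp: invariant_sets_def)
    qed
    ultimately show ?thesis
      using invariant_sets_sums HK by blast
  qed
  then have "e \<in> borel_measurable (invariant_algebra UNIV)"
    by (simp add: borel_measurable_iff_greater)
  \<comment> \<open>The sets to test against already lie in I(K), where the identity defines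
    \<open>e\<close>.\<close>
  moreover have "(\<integral>x\<in>B. indicator A x \<partial>M) = (\<integral>x\<in>B. e x \<partial>M)"
    if "B \<in> invariant_sets M T UNIV" for B
    using set_integral_invariant_exp[OF f, of B K] that invariant_sets_antimono[of K UNIV]
    by (auto simp: e_def)
  moreover have "integrable M e"
    unfolding e_def using f by (rule integrable_invariant_exp)
  ultimately show ?thesis
    unfolding e_def[symmetric] by (intro invariant_exp_charact[OF f]) auto
qed

section \<open>Distance of an indicator from its projection onto I(R^m)\<close>

definition deviation :: "'a set \<Rightarrow> 'a \<Rightarrow> real" where
  "deviation A x = indicator A x - invariant_exp UNIV (indicator A) x"

lemma integrable_deviation: "A \<in> sets M \<Longrightarrow> integrable M (deviation A)"
  unfolding deviation_def by (intro Bochner_Integration.integrable_diff integrable_invariant_exp integrable_indicator_event)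

lemma set_integrable_deviation:
  "A \<in> sets M \<Longrightarrow> B \<in> sets M \<Longrightarrow> set_integrable M B (deviation A)"
  unfolding set_integrable_def by (intro integrable_mult_indicator integrable_deviation)

text \<open>Under the integral over \<open>B\<close> the expectation onto I(R^m) may be replaced by
  the one onto I(K). As \<open>B\<close> lies in I(K), that one has the same integral over
  \<open>B\<close> as the indicator of \<open>A\<close>.\<close>

lemma set_integral_deviation_eq_0:
  assumes A: "A \<in> invariant_sets M T H" and B: "B \<in> invariant_sets M T K"
    and HK: "invariant_sets M T {h + k |h k. h \<in> H \<and> k \<in> K} \<subseteq> invariant_sets M T UNIV"
  shows "(\<integral>x\<in>B. deviation A x \<partial>M) = 0"
proof -
  have AM: "A \<in> sets M" and BM: "B \<in> sets M"
    using A B by (auto simp: invariant_sets_def)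
  have f: "integrable M (indicator A :: 'a \<Rightarrow> real)"
    using AM by (rule integrable_indicator_event)
  note int = this integrable_invariant_exp[OF f]
  have set_int: "set_integrable M B u" if "integrable M u" for u :: "'a \<Rightarrow> real"
    unfolding set_integrable_def using BM that by (intro integrable_mult_indicator)
  have "(\<integral>x\<in>B. deviation A x \<partial>M)
      = (\<integral>x\<in>B. indicator A x \<partial>M) - (\<integral>x\<in>B. invariant_exp UNIV (indicator A) x \<partial>M)"
    unfolding deviation_def by (intro set_integral_diff set_int int)
  also have "(\<integral>x\<in>B. invariant_exp UNIV (indicator A) x \<partial>M)
      = (\<integral>x\<in>B. invariant_exp K (indicator A) x \<partial>M)"
    using invariant_exp_eq_UNIV[OF A HK] int BM
    by (intro set_lebesgue_integral_cong_AE) auto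
  also have "\<dots> = (\<integral>x\<in>B. indicator A x \<partial>M)"
    by (rule set_integral_invariant_exp[OF f B])
  finally show ?thesis
    by simp
qed

lemma abs_deviation_le_1: "A \<in> sets M \<Longrightarrow> AE x in M. \<bar>deviation A x\<bar> \<le> 1"
  by (rule eventually_mono[OF invariant_exp_bounds[OF integrable_indicator_event, of A UNIV]])
    (auto simp: deviation_def indicator_def)

text \<open>With p the projection of the indicator of \<open>A\<close>, the integral is the squared
  L2 norm of the indicator minus p. If it vanished, p would equal the indicator almost everywhere,
  and \<open>A\<close> would be a superlevel set of p up to a null set.\<close>

lemma set_integral_deviation_self_pos:
  assumes A: "A \<in> sets M" "A \<notin> invariant_sets M T UNIV"
  shows "(\<integral>x\<in>A. deviation A x \<partial>M) > 0"
proof (rule ccontr)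
  assume "\<not> ?thesis"
  define p where "p = invariant_exp UNIV (indicator A)"
  have f: "integrable M (indicator A :: 'a \<Rightarrow> real)"
    using A by (intro integrable_indicator_event)
  have p: "integrable M p"
    unfolding p_def using f by (rule integrable_invariant_exp)
  have p01: "AE x in M. p x \<in> {0..1}"
    unfolding p_def using f by (rule invariant_exp_bounds) (simp add: indicator_def)
  have "(\<integral>x\<in>A. deviation A x \<partial>M) \<ge> 0"
    unfolding set_lebesgue_integral_def
    by (intro integral_nonneg_AE eventually_mono[OF p01]) (auto simp: deviation_def indicator_def p_def)
  with \<open>\<not> ?thesis\<close> have "(\<integral>x\<in>A. deviation A x \<partial>M) = 0"
    by simp
  moreover have "(\<integral>x\<in>A. deviation A x \<partial>M) = (\<integral>x. indicator A x *\<^sub>R deviation A x \<partial>M)"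
    by (simp add: set_lebesgue_integral_def)
  ultimately have "AE x in M. indicator A x *\<^sub>R deviation A x = 0"
    using set_integrable_deviation[OF A(1) A(1)]
    by (subst integral_nonneg_eq_0_iff_AE[symmetric])
      (auto simp: set_integrable_def deviation_def indicator_def p_def[symmetric]
        intro: eventually_mono[OF p01])
  \<comment> \<open>The vanishing integral of a nonnegative function gives p = 1 almost everywhere
    on \<open>A\<close>; off \<open>A\<close> only p \<ge> 0 is needed.\<close>
  then have ge: "AE x in M. 0 \<le> p x - indicator A x"
    using p01 by eventually_elim (auto simp: deviation_def indicator_def p_def split: if_splits)
  \<comment> \<open>Testing against the whole space shows that p and the indicator have equal
    integrals, which turns the inequality \<open>ge\<close> into equality almost everywhere.\<close>
  have "space M \<in> invariant_sets M T UNIV"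
    by (auto simp: invariant_sets_def T_in_space)
  from set_integral_invariant_exp[OF f this]
  have "(\<integral>x. p x \<partial>M) = (\<integral>x. indicator A x \<partial>M)"
    using f p by (simp add: p_def set_integral_space)
  then have "(\<integral>x. p x - indicator A x \<partial>M) = 0"
    using f p by simp
  then have eq: "AE x in M. p x - indicator A x = 0"
    using ge f p by (subst integral_nonneg_eq_0_iff_AE[symmetric]) auto
  have "{x \<in> space M. 0 < p x} \<in> invariant_sets M T UNIV"
    using borel_measurable_invariant_exp[of UNIV "indicator A"]
    by (simp add: borel_measurable_iff_greater p_def)
  moreover have "AE x in M. x \<in> A \<longleftrightarrow> x \<in> {x \<in> space M. 0 < p x}"
    using eq AE_space by eventually_elim (auto simp: indicator_def split: if_splits)
  ultimately have "A \<in> invariant_sets M T UNIV"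
    by (rule invariant_sets_AE_cong[OF _ A(1)])
  with A(2) show False ..
qed

text \<open>Subtracting the zero integral over \<open>B\<close> leaves an integrand supported on the
  symmetric difference and bounded by 1 in absolute value.\<close>

lemma deviation_self_le_sym_diff:
  assumes A: "A \<in> sets M" and B: "B \<in> sets M" and 0: "(\<integral>x\<in>B. deviation A x \<partial>M) = 0"
  shows "(\<integral>x\<in>A. deviation A x \<partial>M) \<le> measure M (sym_diff A B)"
proof -
  have int: "integrable M (\<lambda>x. indicator A x *\<^sub>R deviation A x)"
    "integrable M (\<lambda>x. indicator B x *\<^sub>R deviation A x)"
    using set_integrable_deviation A B by (auto simp: set_integrable_def)
  have "(\<integral>x\<in>A. deviation A x \<partial>M)
      = (\<integral>x. indicator A x *\<^sub>R deviation A x - indicator B x *\<^sub>R deviation A x \<partial>M)"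
    using int 0 by (simp add: set_lebesgue_integral_def)
  also have "\<dots> \<le> (\<integral>x. indicator (sym_diff A B) x \<partial>M)"
  proof (rule integral_mono_AE)
    show "AE x in M. indicator A x *\<^sub>R deviation A x - indicator B x *\<^sub>R deviation A x
        \<le> indicator (sym_diff A B) x"
      using abs_deviation_le_1[OF A] by eventually_elim (auto simp: indicator_def)
  qed (use int A B in \<open>auto intro: integrable_indicator_event\<close>)
  also have "\<dots> = measure M (sym_diff A B)"
    using A B by simp
  finally show ?thesis .
qed

section \<open>Countability from separability of the measure algebra\<close>

lemma countable_separated_sets:
  fixes A :: "'i \<Rightarrow> 'a set" and c :: "'i \<Rightarrow> real"
  assumes A: "\<And>i. i \<in> I \<Longrightarrow> A i \<in> sets M" and c: "\<And>i. i \<in> I \<Longrightarrow> c i > 0"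
    and sep: "\<And>i j. i \<in> I \<Longrightarrow> j \<in> I \<Longrightarrow> i \<noteq> j \<Longrightarrow> c i \<le> measure M (sym_diff (A i) (A j))"
  shows "countable I"
proof -
  obtain \<C> where \<C>: "countable \<C>" "\<C> \<subseteq> sets M"
    and dense: "\<And>A e. A \<in> sets M \<Longrightarrow> e > 0 \<Longrightarrow> \<exists>C\<in>\<C>. measure M (sym_diff A C) < e"
    using separable unfolding separable_measure_def by metis
  \<comment> \<open>The radius depends on \<open>i\<close>, as the constants \<open>c i\<close> need
    not have a common positive lower bound.\<close>
  have "\<exists>C\<in>\<C>. measure M (sym_diff (A i) C) < c i / 2" if "i \<in> I" for i
    using that A c by (intro dense) auto
  then obtain F where F: "\<And>i. i \<in> I \<Longrightarrow> F i \<in> \<C>"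
    "\<And>i. i \<in> I \<Longrightarrow> measure M (sym_diff (A i) (F i)) < c i / 2"
    by metis
  have "inj_on F I"
  proof (rule inj_onI, rule ccontr)
    fix i j assume ij: "i \<in> I" "j \<in> I" "F i = F j" "i \<noteq> j"
    have meas: "A i \<in> sets M" "A j \<in> sets M" "F i \<in> sets M"
      using A F(1) \<C>(2) ij by auto
    have "measure M (sym_diff (A i) (A j))
        \<le> measure M (sym_diff (A i) (F i) \<union> sym_diff (A j) (F i))"
      using meas by (intro finite_measure_mono) auto
    also have "\<dots> \<le> measure M (sym_diff (A i) (F i)) + measure M (sym_diff (A j) (F i))"
      using meas by (intro measure_Un_le) auto
    also have "\<dots> < c i / 2 + c j / 2"
      using F(2)[OF ij(1)] F(2)[OF ij(2)] ij(3) by simp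
    finally have "measure M (sym_diff (A i) (A j)) < c i / 2 + c j / 2" .
    moreover have "measure M (sym_diff (A j) (A i)) = measure M (sym_diff (A i) (A j))"
      by (simp add: Un_commute)
    \<comment> \<open>The mean of \<open>c i\<close> and \<open>c j\<close> is at most the larger
      one, so the separation hypothesis fails for one of the two orders.\<close>
    ultimately show False
      using sep[of i j] sep[of j i] ij by auto
  qed
  moreover have "countable (F ` I)"
    using F(1) by (intro countable_subset[OF _ \<C>(1)]) auto
  ultimately show ?thesis
    by (rule countable_image_inj_on[rotated])
qed

section \<open>Maximal subspaces with additional invariant sets, and W(X) as their union\<close>

definition maximal_nonergodic :: "(real ^ 'm) set set" where
  "maximal_nonergodic =
     {V. subspace V \<and> \<not> invariant_sets M T V \<subseteq> invariant_sets M T UNIV \<and>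
        (\<forall>W. subspace W \<longrightarrow> V \<subset> W \<longrightarrow> invariant_sets M T W \<subseteq> invariant_sets M T UNIV)}"

lemma countable_maximal_nonergodic: "countable maximal_nonergodic"
proof -
  have "\<exists>A. A \<in> invariant_sets M T V \<and> A \<notin> invariant_sets M T UNIV" if "V \<in> maximal_nonergodic" for V
    using that by (auto simp: maximal_nonergodic_def)
  then obtain A where A: "\<And>V. V \<in> maximal_nonergodic \<Longrightarrow> A V \<in> invariant_sets M T V"
    "\<And>V. V \<in> maximal_nonergodic \<Longrightarrow> A V \<notin> invariant_sets M T UNIV"
    by metis
  then have AM: "\<And>V. V \<in> maximal_nonergodic \<Longrightarrow> A V \<in> sets M"
    by (simp add: invariant_sets_def)
  show ?thesis
  proof (rule countable_separated_sets[where A = A and c = "\<lambda>V. \<integral>x\<in>A V. deviation (A V) x \<partial>M"])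
    fix V W assume VW: "V \<in> maximal_nonergodic" "W \<in> maximal_nonergodic" "V \<noteq> W"
    define S where "S = {v + w |v w. v \<in> V \<and> w \<in> W}"
    have sub: "subspace V" "subspace W"
      using VW by (auto simp: maximal_nonergodic_def)
    have "V \<subseteq> S" "W \<subseteq> S"
      unfolding S_def using subspace_0[OF sub(1)] subspace_0[OF sub(2)] by force+
    \<comment> \<open>Otherwise both subspaces would equal \<open>S\<close> and hence each other.
      One strict inclusion is enough to apply maximality.\<close>
    with VW(3) have "V \<subset> S \<or> W \<subset> S"
      by blast
    moreover have "subspace S"
      unfolding S_def using sub by (rule subspace_sums)
    ultimately have "invariant_sets M T S \<subseteq> invariant_sets M T UNIV"
      using VW by (auto simp: maximal_nonergodic_def)
    then have "(\<integral>x\<in>A W. deviation (A V) x \<partial>M) = 0"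
      unfolding S_def using A(1) VW by (intro set_integral_deviation_eq_0)
    then show "(\<integral>x\<in>A V. deviation (A V) x \<partial>M) \<le> measure M (sym_diff (A V) (A W))"
      using AM VW by (intro deviation_self_le_sym_diff)
  qed (use AM A set_integral_deviation_self_pos in auto)
qed

text \<open>The families are closed under null modifications and I(R^m) is contained in every I(H),
  so equality modulo null sets reduces to one literal inclusion. The multiples of \<alpha> form its
  span.\<close>

lemma W_set_eq: "W_set M T = {\<alpha>. \<not> invariant_sets M T (span {\<alpha>}) \<subseteq> invariant_sets M T UNIV}"
proof -
  have "eq_mod_null M (invariant_sets M T H) (invariant_sets M T UNIV) \<longleftrightarrow>
      invariant_sets M T H \<subseteq> invariant_sets M T UNIV" for H
  proof
    assume eq: "eq_mod_null M (invariant_sets M T H) (invariant_sets M T UNIV)"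
    show "invariant_sets M T H \<subseteq> invariant_sets M T UNIV"
    proof
      fix A assume A: "A \<in> invariant_sets M T H"
      with eq obtain B where B: "B \<in> invariant_sets M T UNIV" "AE x in M. x \<in> A \<longleftrightarrow> x \<in> B"
        unfolding eq_mod_null_def by blast
      have "A \<in> sets M"
        using A by (simp add: invariant_sets_def)
      then show "A \<in> invariant_sets M T UNIV"
        by (rule invariant_sets_AE_cong[OF B(1) _ B(2)])
    qed
  next
    assume "invariant_sets M T H \<subseteq> invariant_sets M T UNIV"
    then have "invariant_sets M T H = invariant_sets M T UNIV"
      using invariant_sets_antimono[of H UNIV] by auto
    then show "eq_mod_null M (invariant_sets M T H) (invariant_sets M T UNIV)"
      by (auto simp: eq_mod_null_def)
  qed
  then show ?thesis
    by (simp add: W_set_def span_singleton)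
qed

lemma W_set_eq_Union: "W_set M T = \<Union>maximal_nonergodic"
proof (intro subset_antisym subsetI)
  fix \<alpha> assume "\<alpha> \<in> W_set M T"
  define P where "P V \<longleftrightarrow> subspace V \<and> \<alpha> \<in> V \<and> \<not> invariant_sets M T V \<subseteq> invariant_sets M T UNIV" for V
  have "P (span {\<alpha>})"
    using \<open>\<alpha> \<in> W_set M T\<close> by (auto simp: P_def W_set_eq span_base)
  moreover have "dim V \<le> DIM(real ^ 'm)" for V :: "(real ^ 'm) set"
    by (rule dim_subset_UNIV)
  \<comment> \<open>Dimensions are bounded, so some subspace with property \<open>P\<close> has the
    greatest dimension. It is maximal among all subspaces, since anything larger still contains
    \<alpha>.\<close>
  ultimately obtain V where V: "P V" "\<And>W. P W \<Longrightarrow> dim W \<le> dim V"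
    using ex_has_greatest_nat[of P "span {\<alpha>}" dim "Suc DIM(real ^ 'm)"] by (metis less_Suc_eq_le)
  have "invariant_sets M T W \<subseteq> invariant_sets M T UNIV" if "subspace W" "V \<subset> W" for W
  proof (rule ccontr)
    assume "\<not> ?thesis"
    with that V(1) have "P W"
      by (auto simp: P_def)
    then have "dim W \<le> dim V"
      by (rule V(2))
    moreover have "dim V < dim W"
      using that V(1) by (intro dim_psubset) (auto simp: P_def span_eq_iff[THEN iffD2])
    ultimately show False
      by simp
  qed
  with V(1) show "\<alpha> \<in> \<Union>maximal_nonergodic"
    by (auto simp: P_def maximal_nonergodic_def)
next
  fix \<alpha> assume "\<alpha> \<in> \<Union>maximal_nonergodic"
  then obtain V where V: "V \<in> maximal_nonergodic" "\<alpha> \<in> V"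
    by blast
  then have "span {\<alpha>} \<subseteq> V"
    by (intro span_minimal) (auto simp: maximal_nonergodic_def)
  then have "invariant_sets M T V \<subseteq> invariant_sets M T (span {\<alpha>})"
    by (rule invariant_sets_antimono)
  with V(1) show "\<alpha> \<in> W_set M T"
    unfolding W_set_eq maximal_nonergodic_def by blast
qed

end

theorem theorem1p6:
  fixes M :: "'a measure" and T :: "real ^ 'm \<Rightarrow> 'a \<Rightarrow> 'a"
  assumes "R_system M T"
  shows "\<exists>\<V> :: (real ^ 'm) set set.
           countable \<V> \<and> (\<forall>V\<in>\<V>. subspace V \<and> V \<noteq> UNIV) \<and> W_set M T = \<Union>\<V>"
proof -
  interpret R_system M T by fact
  show ?thesis
  proof (intro exI conjI ballI)
    show "countable maximal_nonergodic"
      by (rule countable_maximal_nonergodic)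
    show "W_set M T = \<Union>maximal_nonergodic"
      by (rule W_set_eq_Union)
  \<comment> \<open>Properness: for the whole space the negated inclusion in the definition would be
    trivially false.\<close>
  qed (auto simp: maximal_nonergodic_def)
qed

end
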